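(* Let $G$ be a graph, let $S \subseteq V(G)$ be a secure dominating set of $G$, and let $I_S$ be the set of $S$-isolates, i.e. the set of vertices $v\in S$ having no neighbor in $S$. Then $$\gamma_s(\mu(G)) \leq |S| + |I_S| + 1 .$$
   Context: All graphs are finite, simple, undirected, with nonempty vertex set. A set $S\subseteq V(G)$ is a dominating set of $G$ if every vertex of $V(G)\setminus S$ is adjacent to some vertex of $S$. A dominating set $S$ is a secure dominating set of $G$ if for every $u\in V(G)\setminus S$ there is $v\in S$ adjacent to $u$ such that $(S\setminus\{v\})\cup\{u\}$ is a dominating set of $G$. The secure domination number $\gamma_s(G)$ is the minimum cardinality of a secure dominating set of $G$. For a graph $G$ with vertices $v_1,\dots,v_n$, the Mycielskian $\mu(G)$ is the graph with vertex set $\{v_1,\dots,v_n,u_1,\dots,u_n,w\}$ ($2n+1$ distinct vertices) whose edges are: all edges of $G$; the edges $wu_i$ for $1\le i\le n$; and, for each edge $v_iv_j$ of $G$, the edges $u_iv_j$ and $v_iu_j$. *)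

theory Defs
  imports "Graph_Theory.Pair_Digraph"
begin

text \<open>
  A finite simple undirected graph is a \<^locale>\<open>pair_graph\<close>: an undirected edge between \<open>u\<close> and \<open>v\<close>
  is represented by the two arcs \<open>(u, v)\<close> and \<open>(v, u)\<close>. This locale admits the null graph, so
  nonemptiness of the vertex set is a separate hypothesis where it is wanted.
\<close>

definition dominating_set :: "'a pair_pre_digraph \<Rightarrow> 'a set \<Rightarrow> bool" where
  "dominating_set G S \<longleftrightarrow>
     S \<subseteq> pverts G \<and> (\<forall>u \<in> pverts G - S. \<exists>v \<in> S. (u, v) \<in> parcs G)"

definition secure_dominating_set :: "'a pair_pre_digraph \<Rightarrow> 'a set \<Rightarrow> bool" where
  "secure_dominating_set G S \<longleftrightarrow>
     dominating_set G S \<and>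
     (\<forall>u \<in> pverts G - S. \<exists>v \<in> S. (u, v) \<in> parcs G \<and> dominating_set G ((S - {v}) \<union> {u}))"

text \<open>
  In a finite graph the minimum is attained, because the whole vertex set is a secure dominating
  set; see \<open>secure_domination_number_attained\<close> below.
\<close>

definition secure_domination_number :: "'a pair_pre_digraph \<Rightarrow> nat" where
  "secure_domination_number G = (LEAST k. \<exists>S. secure_dominating_set G S \<and> card S = k)"

definition isolates :: "'a pair_pre_digraph \<Rightarrow> 'a set \<Rightarrow> 'a set" where
  "isolates G S = {v \<in> S. \<not> (\<exists>u \<in> S. (v, u) \<in> parcs G)}"

text \<open>
  \<open>Orig v\<close> is the vertex \<open>v\<^sub>i\<close> of the original graph, \<open>Copy v\<close> is the corresponding \<open>u\<^sub>i\<close>, and \<open>Apex\<close>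
  is \<open>w\<close>.
\<close>

datatype 'a mycielski_vertex = Orig 'a | Copy 'a | Apex

definition mycielskian :: "'a pair_pre_digraph \<Rightarrow> 'a mycielski_vertex pair_pre_digraph" where
  "mycielskian G =
     \<lparr> pverts = Orig ` pverts G \<union> Copy ` pverts G \<union> {Apex},
       parcs = {(Orig x, Orig y) | x y. (x, y) \<in> parcs G}
             \<union> {(Apex, Copy x) | x. x \<in> pverts G}
             \<union> {(Copy x, Apex) | x. x \<in> pverts G}
             \<union> {(Copy x, Orig y) | x y. (x, y) \<in> parcs G}
             \<union> {(Orig x, Copy y) | x y. (x, y) \<in> parcs G} \<rparr>"

lemma pair_graph_mycielskian:
  assumes "pair_graph G"
  shows "pair_graph (mycielskian G)"
proof -
  interpret pair_graph G by fact
  have V: "finite (pverts (mycielskian G))"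
    by (simp add: mycielskian_def pair_finite_verts)
  have sub: "parcs (mycielskian G) \<subseteq> pverts (mycielskian G) \<times> pverts (mycielskian G)"
    by (auto simp: mycielskian_def dest: wellformed')
  have "finite (parcs (mycielskian G))"
    using sub V by (meson finite_SigmaI finite_subset)
  moreover have "sym (parcs (mycielskian G))"
    by (auto simp: mycielskian_def sym_def dest: arcs_symmetric)
  moreover have "fst e \<noteq> snd e" if "e \<in> parcs (mycielskian G)" for e
    using that by (auto simp: mycielskian_def dest: no_loops')
  ultimately show ?thesis
    using V sub by unfold_locales (auto simp: symmetric_def)
qed

lemma card_verts_mycielskian:
  assumes "finite (pverts G)"
  shows "card (pverts (mycielskian G)) = 2 * card (pverts G) + 1"
proof -
  have "card (Orig ` pverts G \<union> Copy ` pverts G) = card (pverts G) + card (pverts G)"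
    using assms by (subst card_Un_disjoint) (auto simp: card_image inj_on_def)
  moreover have "Apex \<notin> Orig ` pverts G \<union> Copy ` pverts G" by auto
  ultimately show ?thesis
    using assms by (simp add: mycielskian_def)
qed

lemma secure_dominating_set_verts: "secure_dominating_set G (pverts G)"
  by (simp add: secure_dominating_set_def dominating_set_def)

lemma secure_domination_number_attained:
  "\<exists>S. secure_dominating_set G S \<and> card S = secure_domination_number G"
  unfolding secure_domination_number_def
  by (rule LeastI_ex) (use secure_dominating_set_verts in blast)

lemma secure_domination_number_le:
  "secure_dominating_set G S \<Longrightarrow> secure_domination_number G \<le> card S"
  unfolding secure_domination_number_def by (rule Least_le) blast

end

theory Submission
  imports Defs
begin

text \<open>
  The set \<open>Orig ` S \<union> Copy ` isolates G S \<union> {Apex}\<close> has at most the required size, and it is a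
  secure dominating set of the Mycielskian. The apex dominates all copies, so an original vertex
  outside \<open>S\<close> can be defended exactly as in \<open>G\<close>
  (\<open>dominating_set_mycielskian_with_apex\<close>). A copy that is not in the set is defended by the
  apex. Once the apex has moved, the copies must be dominated by original vertices: this works for
  the copy of any vertex with a neighbour in \<open>S\<close>, hence for all but the copies of the \<open>S\<close>-isolates,
  and these have been put into the set
  (\<open>dominating_set_mycielskian_without_apex\<close>).
\<close>

lemma dominating_set_mycielskian_with_apex:
  assumes "dominating_set G D" and "C \<subseteq> pverts G"
  shows "dominating_set (mycielskian G) (Orig ` D \<union> Copy ` C \<union> {Apex})"
  using assms unfolding dominating_set_def mycielskian_def by fastforce

text \<open>
  Being dominated in \<open>G\<close> gives a vertex outside \<open>D\<close> a neighbour in \<open>D\<close>, but a vertex of \<open>D\<close> need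
  not have one. If it has none, no vertex of \<open>Orig ` D\<close> is adjacent to its copy, which is why
  \<open>C\<close> must contain the isolates. Any element of \<open>C\<close> yields a copy that dominates the apex.
\<close>

lemma dominating_set_mycielskian_without_apex:
  assumes D: "dominating_set G D" and C: "C \<subseteq> pverts G" "isolates G D \<subseteq> C" "C \<noteq> {}"
  shows "dominating_set (mycielskian G) (Orig ` D \<union> Copy ` C)"
proof -
  have nbr: "\<exists>y \<in> D. (x, y) \<in> parcs G" if "x \<in> pverts G" "x \<notin> C" for x
    using that D C(2) unfolding dominating_set_def isolates_def by blast
  have "\<exists>q \<in> Orig ` D \<union> Copy ` C. (p, q) \<in> parcs (mycielskian G)"
    if "p \<in> pverts (mycielskian G) - (Orig ` D \<union> Copy ` C)" for p
  proof (cases p)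
    case (Orig x)
    then show ?thesis
      using that D by (fastforce simp: dominating_set_def mycielskian_def)
  next
    case (Copy x)
    then have "x \<in> pverts G" "x \<notin> C"
      using that by (auto simp: mycielskian_def)
    from nbr[OF this] show ?thesis
      using Copy by (auto simp: mycielskian_def)
  next
    case Apex
    then show ?thesis
      using C by (fastforce simp: mycielskian_def)
  qed
  then show ?thesis
    using D C(1) by (auto simp: dominating_set_def mycielskian_def)
qed

lemma secure_dominating_set_mycielskian:
  assumes S: "secure_dominating_set G S"
  shows "secure_dominating_set (mycielskian G) (Orig ` S \<union> Copy ` isolates G S \<union> {Apex})"
    (is "secure_dominating_set _ ?T")
proof -
  have dom: "dominating_set G S"
    using S by (simp add: secure_dominating_set_def)
  have I: "isolates G S \<subseteq> pverts G"
    using dom by (auto simp: dominating_set_def isolates_def)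
  have "\<exists>q \<in> ?T. (p, q) \<in> parcs (mycielskian G) \<and>
          dominating_set (mycielskian G) ((?T - {q}) \<union> {p})"
    if p: "p \<in> pverts (mycielskian G) - ?T" for p
  proof (cases p)
    case (Orig x)
    then have "x \<in> pverts G - S"
      using p by (auto simp: mycielskian_def)
    then obtain v where v: "v \<in> S" "(x, v) \<in> parcs G" "dominating_set G ((S - {v}) \<union> {x})"
      using S by (auto simp: secure_dominating_set_def)
    have "(?T - {Orig v}) \<union> {p} = Orig ` ((S - {v}) \<union> {x}) \<union> Copy ` isolates G S \<union> {Apex}"
      using Orig by auto
    then have "dominating_set (mycielskian G) ((?T - {Orig v}) \<union> {p})"
      using dominating_set_mycielskian_with_apex[OF v(3) I] by simp
    moreover have "(p, Orig v) \<in> parcs (mycielskian G)"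
      using Orig v(2) by (auto simp: mycielskian_def)
    ultimately show ?thesis
      using v(1) by blast
  next
    case (Copy x)
    then have x: "x \<in> pverts G"
      using p by (auto simp: mycielskian_def)
    have "(?T - {Apex}) \<union> {p} = Orig ` S \<union> Copy ` insert x (isolates G S)"
      using Copy by auto
    moreover have "dominating_set (mycielskian G) (Orig ` S \<union> Copy ` insert x (isolates G S))"
      by (rule dominating_set_mycielskian_without_apex[OF dom]) (use x I in auto)
    moreover have "(p, Apex) \<in> parcs (mycielskian G)"
      using Copy x by (auto simp: mycielskian_def)
    ultimately show ?thesis
      by (intro bexI[of _ Apex]) auto
  next
    case Apex
    then show ?thesis
      using p by simp
  qed
  then show ?thesis
    using dominating_set_mycielskian_with_apex[OF dom I]
    unfolding secure_dominating_set_def by blast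
qed

theorem corollary2p1:
  fixes G :: "'a pair_pre_digraph" and S :: "'a set"
  assumes "pair_graph G"
    and "pverts G \<noteq> {}"
    and "secure_dominating_set G S"
  shows "secure_domination_number (mycielskian G) \<le> card S + card (isolates G S) + 1"
proof -
  let ?O = "Orig ` S" and ?C = "Copy ` isolates G S"
  have "secure_domination_number (mycielskian G) \<le> card (?O \<union> ?C \<union> {Apex})"
    by (rule secure_domination_number_le[OF secure_dominating_set_mycielskian[OF assms(3)]])
  also have "\<dots> \<le> card ?O + card ?C + 1"
    using card_Un_le[of "?O \<union> ?C" "{Apex}"] card_Un_le[of ?O ?C] by simp
  also have "\<dots> = card S + card (isolates G S) + 1"
    by (simp add: card_image inj_on_def)
  finally show ?thesis .
qed

end
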